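(* Let $\tau,\delta\in\mathbb{R}$ and $$M=\begin{pmatrix}\tau & 1\\ -\delta & 0\end{pmatrix}.$$ Define $a_{-1}=0$ and, for every integer $n\ge 0$, $$a_n=\sum_{m=0}^{\lfloor n/2\rfloor}(-1)^m\binom{n-m}{m}\,\delta^m\,\tau^{n-2m}.$$ Then for every integer $n\ge1$, $$M^n=\begin{pmatrix}a_n & a_{n-1}\\ -\delta a_{n-1} & -\delta a_{n-2}\end{pmatrix}.$$
   Context: $\lfloor\cdot\rfloor$ is the greatest integer function, $\binom{p}{r}$ is the binomial coefficient (the coefficient of $x^r$ in $(1+x)^p$), and the convention $0^0=1$ is used. *)

theory Defs
  imports Complex_Main "Jordan_Normal_Form.Matrix"
begin

end

theory Submission
  imports Defs
begin

text \<open>Pascal's rule gives \<open>a\<^sub>k\<^sub>+\<^sub>2 = \<tau> a\<^sub>k\<^sub>+\<^sub>1 - \<delta> a\<^sub>k\<close> term by term, and the convention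
  \<open>a\<^sub>-\<^sub>1 = 0\<close> extends this to \<open>k = -1\<close>. The matrix formula is preserved by multiplication
  with \<open>M\<close> on the right precisely because of this recurrence.\<close>

text \<open>The letters \<open>\<tau>\<close> and \<open>\<delta>\<close> are the trace and
  determinant of the matrix \<open>M\<close> of the theorem.\<close>

definition trace_det_term :: "'a::comm_ring_1 \<Rightarrow> 'a \<Rightarrow> nat \<Rightarrow> nat \<Rightarrow> 'a" where
  "trace_det_term \<tau> \<delta> k m = (- 1) ^ m * of_nat ((k - m) choose m) * \<delta> ^ m * \<tau> ^ (k - 2 * m)"

lemma trace_det_term_eq_0:
  assumes "k < 2 * m"
  shows "trace_det_term \<tau> \<delta> k m = 0"
  using assms by (simp add: trace_det_term_def binomial_eq_0)

text \<open>The added terms have vanishing binomials. The bound without \<open>div\<close> lets the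
  sums for \<open>k\<close>, \<open>k + 1\<close> and \<open>k + 2\<close> be compared with no split
  by parity.\<close>

lemma sum_trace_det_term_half:
  "(\<Sum>m = 0..k div 2. trace_det_term \<tau> \<delta> k m) = (\<Sum>m\<le>k. trace_det_term \<tau> \<delta> k m)"
  by (rule sum.mono_neutral_left) (auto intro!: trace_det_term_eq_0)

lemma trace_det_term_Suc_Suc:
  assumes "m \<le> k"
  shows "trace_det_term \<tau> \<delta> (Suc (Suc k)) (Suc m) =
    \<tau> * trace_det_term \<tau> \<delta> (Suc k) (Suc m) - \<delta> * trace_det_term \<tau> \<delta> k m"
proof (cases "2 * m < k")
  case True
  then obtain d where "k = Suc (2 * m + d)"
    by (auto dest: less_imp_Suc_add)
  then show ?thesis
    by (simp add: trace_det_term_def Suc_diff_le algebra_simps)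
next
  \<comment> \<open>Now the exponent \<open>Suc k - 2 * Suc m\<close> is truncated to 0, but its
    coefficient \<open>(k - m) choose Suc m\<close> is 0 because
    \<open>k - m \<le> m\<close>.\<close>
  case False
  with assms show ?thesis
    by (simp add: trace_det_term_def Suc_diff_le binomial_eq_0 algebra_simps)
qed

lemma sum_trace_det_term_Suc_Suc:
  "(\<Sum>m\<le>Suc (Suc k). trace_det_term \<tau> \<delta> (Suc (Suc k)) m) =
    \<tau> * (\<Sum>m\<le>Suc k. trace_det_term \<tau> \<delta> (Suc k) m) - \<delta> * (\<Sum>m\<le>k. trace_det_term \<tau> \<delta> k m)"
proof -
  \<comment> \<open>The shifted sum would run up to \<open>Suc k\<close>; its last term, with both
    indices \<open>Suc (Suc k)\<close>, is zero and is dropped.\<close>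
  have "(\<Sum>m\<le>Suc (Suc k). trace_det_term \<tau> \<delta> (Suc (Suc k)) m) =
      trace_det_term \<tau> \<delta> (Suc (Suc k)) 0 + (\<Sum>m\<le>k. trace_det_term \<tau> \<delta> (Suc (Suc k)) (Suc m))"
    by (subst sum.atMost_Suc_shift) (simp add: trace_det_term_eq_0)
  also have "\<dots> = \<tau> * trace_det_term \<tau> \<delta> (Suc k) 0 +
      (\<Sum>m\<le>k. \<tau> * trace_det_term \<tau> \<delta> (Suc k) (Suc m) - \<delta> * trace_det_term \<tau> \<delta> k m)"
    by (simp add: trace_det_term_Suc_Suc) (simp add: trace_det_term_def)
  also have "\<dots> = \<tau> * (\<Sum>m\<le>Suc k. trace_det_term \<tau> \<delta> (Suc k) m) -
      \<delta> * (\<Sum>m\<le>k. trace_det_term \<tau> \<delta> k m)"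
    by (simp only: sum.atMost_Suc_shift) (simp add: sum_subtractf sum_distrib_left algebra_simps)
  finally show ?thesis .
qed

lemma mult_mat_of_rows_list_2:
  fixes p q r s :: "'a::semiring_0"
  shows "mat_of_rows_list 2 [[p, q], [r, s]] * mat_of_rows_list 2 [[t, u], [v, w]] =
    mat_of_rows_list 2 [[p * t + q * v, p * u + q * w], [r * t + s * v, r * u + s * w]]"
  by (rule eq_matI)
    (auto simp: mat_of_rows_list_def scalar_prod_def numeral_2_eq_2 less_Suc_eq)

theorem mainTheorem3:
  fixes \<tau> \<delta> :: real and M :: "real mat" and a :: "int \<Rightarrow> real" and n :: nat
  assumes M: "M = mat_of_rows_list 2 [[\<tau>, 1], [- \<delta>, 0]]"
    and a_minus_one: "a (- 1) = 0"
    and a_nonneg: "\<And>k :: nat. a (int k) =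
          (\<Sum>m = 0..k div 2. (- 1) ^ m * real ((k - m) choose m) * \<delta> ^ m * \<tau> ^ (k - 2 * m))"
    and n: "n \<ge> 1"
  shows "M ^\<^sub>m n = mat_of_rows_list 2
           [[a (int n), a (int n - 1)],
            [- \<delta> * a (int n - 1), - \<delta> * a (int n - 2)]]"
proof -
  have a_sum: "a (int k) = (\<Sum>m\<le>k. trace_det_term \<tau> \<delta> k m)" for k
    unfolding sum_trace_det_term_half[symmetric] by (simp add: a_nonneg trace_det_term_def)
  have a_0: "a 0 = 1" and a_1: "a 1 = \<tau>"
    using a_nonneg[of 0] a_nonneg[of 1] by simp_all
  have a_rec: "a (int k + 1) = \<tau> * a (int k) - \<delta> * a (int k - 1)" for k
  proof (cases k)
    case 0
    then show ?thesis
      by (simp add: a_0 a_1 a_minus_one)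
  next
    case (Suc j)
    then show ?thesis
      using sum_trace_det_term_Suc_Suc[of \<tau> \<delta> j, folded a_sum] by (simp add: algebra_simps)
  qed
  show ?thesis
    using n
  proof (induction n rule: dec_induct)
    case base
    \<comment> \<open>The first power unfolds to an identity matrix times \<open>M\<close>; the
      dimensions allow the identity to be cancelled.\<close>
    have "M \<in> carrier_mat 2 2"
      by (simp add: M mat_of_rows_list_def numeral_2_eq_2)
    then show ?case
      by (simp add: a_0 a_1 a_minus_one) (simp add: M)
  next
    case (step k)
    \<comment> \<open>Since \<open>k \<ge> 1\<close>, the recurrence is also available one index
      lower; for \<open>k = 1\<close> it involves \<open>a (- 1)\<close>.\<close>
    then obtain j where "k = Suc j"
      by (cases k) auto
    then have a_k: "a (int k) = \<tau> * a (int k - 1) - \<delta> * a (int k - 2)"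
      using a_rec[of j] by (simp add: algebra_simps)
    \<comment> \<open>The old first column becomes the second. The new first column contains the
      recurrence for \<open>a (int k + 1)\<close> and, times \<open>- \<delta>\<close>, the one for
      \<open>a (int k)\<close>.\<close>
    have "M ^\<^sub>m Suc k = mat_of_rows_list 2
        [[\<tau> * a (int k) - \<delta> * a (int k - 1), a (int k)],
         [- \<delta> * (\<tau> * a (int k - 1) - \<delta> * a (int k - 2)), - \<delta> * a (int k - 1)]]"
      unfolding pow_mat.simps step.IH unfolding M mult_mat_of_rows_list_2
      by (simp add: algebra_simps)
    also have "\<dots> = mat_of_rows_list 2
        [[a (int k + 1), a (int k)], [- \<delta> * a (int k), - \<delta> * a (int k - 1)]]"
      by (simp only: a_rec a_k[symmetric])
    finally show ?case
      by (simp add: add.commute)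
  qed
qed

end
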